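(* Let $L,T,\delta>0$ and $(\epsilon_1,\epsilon_2)\in(0,T/2)^2$. Then there exists a positive function $y=y(x,t)$, of class $C^\infty$ on $\{(x,t): x\in\mathbb{R},\ t\in[0,T]\}$, which solves the Korteweg-de Vries equation $$y_t+y_x+y_{xxx}+yy_x=0,\qquad x\in\mathbb{R},\ t\in[0,T],$$ such that $$\|y(\cdot,t)\|_{H^2(0,L)}<\delta,\qquad \forall t\in(0,\epsilon_1)\cup(T-\epsilon_2,T),$$ and such that the flow $\Phi$ associated to $y$ satisfies $$\Phi(x,t)\ge L,\qquad \forall (x,t)\in[0,L]\times(T-\epsilon_2,T).$$
   Context: Flow associated to $y$: set $$\hat y(x,t)=\begin{cases} y(0,t), & x\le 0,\\ y(x,t), & x\in[0,L],\\ y(L,t), & x\ge L,\end{cases}$$ and let $\Phi$ be the solution of $\frac{\partial\Phi}{\partial t}(x,t)=\hat y(\Phi(x,t),t)$, $\Phi(x,0)=x$, for $x\in\mathbb{R}$, $t\in[0,T]$. *)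

theory Defs
  imports "HOL-Analysis.Analysis"
begin

text \<open>
  A function of space and time is curried, \<open>y x t\<close>. It is considered on the closed strip
  of all \<open>(x, t)\<close> with \<open>t \<in> {0..T}\<close> only; its values for other \<open>t\<close> are irrelevant. Accordingly,
  time derivatives are taken within \<open>{0..T}\<close> and so are one-sided at \<open>t = 0\<close> and \<open>t = T\<close>.
\<close>

definition dx :: "(real \<Rightarrow> real \<Rightarrow> real) \<Rightarrow> real \<Rightarrow> real \<Rightarrow> real" where
  "dx f x t = deriv (\<lambda>\<xi>. f \<xi> t) x"

definition dt :: "real \<Rightarrow> (real \<Rightarrow> real \<Rightarrow> real) \<Rightarrow> real \<Rightarrow> real \<Rightarrow> real" where
  "dt T f x t = vector_derivative (\<lambda>s. f x s) (at t within {0..T})"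

text \<open>
  Class \<open>C\<^sup>k\<close> up to the boundary of the strip: all iterated partial derivatives of order at most
  \<open>k\<close>, in any order of differentiation, exist and are jointly continuous on the closed strip. The
  differentiability requirement is needed because \<open>dx\<close> and \<open>dt\<close> are total.
\<close>

primrec Ck_strip :: "nat \<Rightarrow> real \<Rightarrow> (real \<Rightarrow> real \<Rightarrow> real) \<Rightarrow> bool" where
  "Ck_strip 0 T f \<longleftrightarrow> continuous_on (UNIV \<times> {0..T}) (\<lambda>(x, t). f x t)"
| "Ck_strip (Suc k) T f \<longleftrightarrow>
     continuous_on (UNIV \<times> {0..T}) (\<lambda>(x, t). f x t) \<and>
     (\<forall>x. \<forall>t\<in>{0..T}. (\<lambda>\<xi>. f \<xi> t) differentiable (at x)) \<and>
     (\<forall>x. \<forall>t\<in>{0..T}. (\<lambda>s. f x s) differentiable (at t within {0..T})) \<and>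
     Ck_strip k T (dx f) \<and> Ck_strip k T (dt T f)"

definition smooth_strip :: "real \<Rightarrow> (real \<Rightarrow> real \<Rightarrow> real) \<Rightarrow> bool" where
  "smooth_strip T f \<longleftrightarrow> (\<forall>k. Ck_strip k T f)"

definition solves_KdV :: "real \<Rightarrow> (real \<Rightarrow> real \<Rightarrow> real) \<Rightarrow> bool" where
  "solves_KdV T y \<longleftrightarrow>
     (\<forall>x. \<forall>t\<in>{0..T}. dt T y x t + dx y x t + dx (dx (dx y)) x t + y x t * dx y x t = 0)"

text \<open>
  The norm of \<open>H\<^sup>2(0,L)\<close>, written with classical derivatives. It is meant only for functions that
  are \<open>C\<^sup>2\<close> on a neighbourhood of \<open>{0..L}\<close>, for which weak and classical derivatives agree
  and the integral is finite.
\<close>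

definition H2_norm :: "real \<Rightarrow> (real \<Rightarrow> real) \<Rightarrow> real" where
  "H2_norm L u =
     sqrt (LINT x:{0<..<L}|lborel. (u x)\<^sup>2 + (deriv u x)\<^sup>2 + (deriv (deriv u) x)\<^sup>2)"

definition yhat :: "real \<Rightarrow> (real \<Rightarrow> real \<Rightarrow> real) \<Rightarrow> real \<Rightarrow> real \<Rightarrow> real" where
  "yhat L y x t = (if x \<le> 0 then y 0 t else if x \<le> L then y x t else y L t)"

definition is_flow ::
  "real \<Rightarrow> real \<Rightarrow> (real \<Rightarrow> real \<Rightarrow> real) \<Rightarrow> (real \<Rightarrow> real \<Rightarrow> real) \<Rightarrow> bool" where
  "is_flow L T y \<Phi> \<longleftrightarrow>
     (\<forall>x. \<Phi> x 0 = x \<and>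
       (\<forall>t\<in>{0..T}. ((\<lambda>s. \<Phi> x s) has_real_derivative yhat L y (\<Phi> x t) t) (at t within {0..T})))"

end

theory Submission
  imports Defs "HOL-Computational_Algebra.Polynomial" "HOL-Real_Asymp.Real_Asymp"
begin

text \<open>
  A single soliton \<open>12 \<kappa>\<^sup>2 sech\<^sup>2 (\<kappa> (x - c (t - T/2)))\<close> with \<open>c = 1 + 4 \<kappa>\<^sup>2\<close> and \<open>\<kappa>\<close> large
  suffices. Its crest crosses \<open>[0, L]\<close> shortly after \<open>t = T/2\<close>; before \<open>\<epsilon>\<^sub>1\<close> and after \<open>T - \<epsilon>\<^sub>2\<close> it is
  at distance of order \<open>\<kappa>\<^sup>2\<close> from \<open>[0, L]\<close>, so that the norm is of order \<open>\<kappa>\<^sup>4\<close> times a decaying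
  exponential. The crest value \<open>12 \<kappa>\<^sup>2\<close> exceeds the speed \<open>c\<close>, so particles ahead of the crest
  are never overtaken by it and are swept past \<open>L\<close>.
\<close>

section \<open>Travelling waves that are polynomials in tanh\<close>

definition phase :: "real \<Rightarrow> real \<Rightarrow> real \<Rightarrow> real \<Rightarrow> real" where
  "phase \<kappa> s x t = \<kappa> * (x - (1 + 4 * \<kappa>\<^sup>2) * (t - s))"

text \<open>Since tanh' = 1 - tanh^2, functions of this form are closed under both partial
  derivatives. Smoothness then becomes an induction over polynomials, and the differential equation
  a polynomial identity.\<close>

definition tanh_poly :: "real \<Rightarrow> real \<Rightarrow> real poly \<Rightarrow> real \<Rightarrow> real \<Rightarrow> real" where
  "tanh_poly \<kappa> s p x t = poly p (tanh (phase \<kappa> s x t))"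

text \<open>Encodes sech^2 as 1 - tanh^2.\<close>

definition soliton_poly :: "real \<Rightarrow> real poly" where
  "soliton_poly \<kappa> = [:12 * \<kappa>\<^sup>2, 0, - 12 * \<kappa>\<^sup>2:]"

definition soliton :: "real \<Rightarrow> real \<Rightarrow> real \<Rightarrow> real \<Rightarrow> real" where
  "soliton \<kappa> s = tanh_poly \<kappa> s (soliton_poly \<kappa>)"

definition tanh_pderiv :: "real poly \<Rightarrow> real poly" where
  "tanh_pderiv p = [:1, 0, -1:] * pderiv p"

lemma poly_tanh_has_derivative:
  "((\<lambda>z. poly p (tanh z)) has_real_derivative poly (tanh_pderiv p) (tanh z)) (at z)"
  unfolding tanh_pderiv_def
  by (auto intro!: derivative_eq_intros simp: cosh_real_nonzero algebra_simps power2_eq_square)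

lemma tanh_poly_has_derivative_x:
  "((\<lambda>x. tanh_poly \<kappa> s p x t) has_real_derivative
     tanh_poly \<kappa> s (smult \<kappa> (tanh_pderiv p)) x t) (at x within A)"
proof -
  have "((\<lambda>x. phase \<kappa> s x t) has_real_derivative \<kappa>) (at x within A)"
    unfolding phase_def by (auto intro!: derivative_eq_intros)
  from DERIV_chain2[OF poly_tanh_has_derivative this]
  show ?thesis by (simp add: tanh_poly_def mult.commute)
qed

lemma tanh_poly_has_derivative_t:
  "((\<lambda>t. tanh_poly \<kappa> s p x t) has_real_derivative
     tanh_poly \<kappa> s (smult (- \<kappa> * (1 + 4 * \<kappa>\<^sup>2)) (tanh_pderiv p)) x t) (at t within A)"
proof -
  have "((\<lambda>t. phase \<kappa> s x t) has_real_derivative - \<kappa> * (1 + 4 * \<kappa>\<^sup>2)) (at t within A)"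
    unfolding phase_def by (auto intro!: derivative_eq_intros simp: algebra_simps)
  from DERIV_chain2[OF poly_tanh_has_derivative this]
  show ?thesis by (simp add: tanh_poly_def mult.commute)
qed

lemma dx_tanh_poly: "dx (tanh_poly \<kappa> s p) = tanh_poly \<kappa> s (smult \<kappa> (tanh_pderiv p))"
  by (intro ext) (simp add: dx_def DERIV_imp_deriv[OF tanh_poly_has_derivative_x])

lemma dt_cong: "dt T f x t = dt T g x t" if "t \<in> {0..T}" "\<And>u. u \<in> {0..T} \<Longrightarrow> f x u = g x u"
  unfolding dt_def
  by (intro vector_derivative_cong_eq) (use that in \<open>auto simp: eventually_at_filter\<close>)

text \<open>With \<open>0 < T\<close> no point of \<open>{0..T}\<close> is isolated, so derivatives
  within the interval are unique; at the end points they equal the two-sided derivative of the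
  formula.\<close>

lemma dt_tanh_poly:
  assumes "0 < T" "t \<in> {0..T}"
  shows "dt T (tanh_poly \<kappa> s p) x t =
    tanh_poly \<kappa> s (smult (- \<kappa> * (1 + 4 * \<kappa>\<^sup>2)) (tanh_pderiv p)) x t"
  unfolding dt_def
  by (rule vector_derivative_within_closed_interval[OF assms])
     (use tanh_poly_has_derivative_t in \<open>simp add: has_real_derivative_iff_has_vector_derivative\<close>)

lemma continuous_on_tanh_poly: "continuous_on A (\<lambda>z. tanh_poly \<kappa> s p (fst z) (snd z))"
  unfolding tanh_poly_def phase_def by (intro continuous_intros) simp

text \<open>Agreement is only assumed on the strip because \<open>dt\<close> takes junk values outside of it.\<close>
lemma Ck_strip_tanh_poly:
  assumes "0 < T" and "\<And>x t. t \<in> {0..T} \<Longrightarrow> f x t = tanh_poly \<kappa> s p x t"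
  shows "Ck_strip k T f"
proof -
  have cont: "continuous_on (UNIV \<times> {0..T}) (\<lambda>(x, t). f x t)"
    if "\<And>x t. t \<in> {0..T} \<Longrightarrow> f x t = tanh_poly \<kappa> s p x t" for f p
    using continuous_on_tanh_poly[of "UNIV \<times> {0..T}" \<kappa> s p]
    by (rule continuous_on_eq) (use that in auto)
  show ?thesis
    using assms(2)
  \<comment> \<open>Both \<open>f\<close> and \<open>p\<close> must vary: on the strip,
    \<open>dx f\<close> and \<open>dt T f\<close> are again of the form \<open>tanh_poly\<close>,
    with new polynomials.\<close>
  proof (induction k arbitrary: f p)
    case 0
    then show ?case using cont by simp
  next
    case (Suc k)
    have 1: "continuous_on (UNIV \<times> {0..T}) (\<lambda>(x, t). f x t)"
      using Suc.prems by (rule cont)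
    have 2: "(\<lambda>\<xi>. f \<xi> t) differentiable (at x)" if "t \<in> {0..T}" for x t
      using tanh_poly_has_derivative_x[of \<kappa> s p t] that
      by (auto simp: Suc.prems real_differentiable_def)
    have 3: "(\<lambda>u. f x u) differentiable (at t within {0..T})" if "t \<in> {0..T}" for x t
    proof -
      have "((\<lambda>u. f x u) has_real_derivative
          tanh_poly \<kappa> s (smult (- \<kappa> * (1 + 4 * \<kappa>\<^sup>2)) (tanh_pderiv p)) x t) (at t within {0..T})"
        by (rule has_field_derivative_transform_within[OF tanh_poly_has_derivative_t zero_less_one that])
           (simp add: Suc.prems)
      then show ?thesis by (auto simp: real_differentiable_def)
    qed
    have 4: "dx f x t = tanh_poly \<kappa> s (smult \<kappa> (tanh_pderiv p)) x t" if "t \<in> {0..T}" for x t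
    proof -
      have "dx f x t = dx (tanh_poly \<kappa> s p) x t"
        unfolding dx_def using that by (simp add: Suc.prems)
      then show ?thesis by (simp add: dx_tanh_poly)
    qed
    have 5: "dt T f x t = tanh_poly \<kappa> s (smult (- \<kappa> * (1 + 4 * \<kappa>\<^sup>2)) (tanh_pderiv p)) x t"
      if "t \<in> {0..T}" for x t
      using dt_cong[OF that, of f x "tanh_poly \<kappa> s p"] dt_tanh_poly[OF assms(1) that] Suc.prems
      by simp
    show ?case
      using 1 2 3 Suc.IH[of "dx f", OF 4] Suc.IH[of "dt T f", OF 5] by simp
  qed
qed

section \<open>The soliton: equation, positivity, derivatives\<close>

text \<open>All terms are polynomials in tanh of the same phase. The speed 1 + 4 \<kappa>^2 gives
  u_t + u_x = -4 \<kappa>^2 u_x, and the amplitude 12 \<kappa>^2 gives u_xxx + u u_x = 4 \<kappa>^2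
  u_x.\<close>

lemma soliton_solves_KdV: "0 < T \<Longrightarrow> solves_KdV T (soliton \<kappa> s)"
  unfolding solves_KdV_def soliton_def
  by (auto simp: dt_tanh_poly dx_tanh_poly)
     (simp add: tanh_poly_def tanh_pderiv_def soliton_poly_def pderiv_pCons algebra_simps
        power2_eq_square)

lemma one_minus_tanh_square: "1 - (tanh z)\<^sup>2 = 1 / (cosh z)\<^sup>2" for z :: real
  using hyperbolic_pythagoras[of z] cosh_real_nonzero[of z]
  by (simp add: tanh_def power_divide divide_simps)

lemma soliton_altdef: "soliton \<kappa> s x t = 12 * \<kappa>\<^sup>2 / (cosh (phase \<kappa> s x t))\<^sup>2"
proof -
  have "12 * \<kappa>\<^sup>2 / (cosh (phase \<kappa> s x t))\<^sup>2 = 12 * \<kappa>\<^sup>2 * (1 - (tanh (phase \<kappa> s x t))\<^sup>2)"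
    by (simp add: one_minus_tanh_square)
  then show ?thesis
    by (simp add: soliton_def tanh_poly_def soliton_poly_def algebra_simps power2_eq_square)
qed

lemma soliton_pos: "\<kappa> \<noteq> 0 \<Longrightarrow> 0 < soliton \<kappa> s x t"
  by (simp add: soliton_altdef cosh_real_pos)

lemma deriv_soliton:
  "deriv (\<lambda>x. soliton \<kappa> s x t) x =
     - 24 * \<kappa>^3 * tanh (phase \<kappa> s x t) / (cosh (phase \<kappa> s x t))\<^sup>2"
  "deriv (deriv (\<lambda>x. soliton \<kappa> s x t)) x =
     24 * \<kappa>^4 * (3 * (tanh (phase \<kappa> s x t))\<^sup>2 - 1) / (cosh (phase \<kappa> s x t))\<^sup>2"
proof -
  have d: "deriv (\<lambda>x. tanh_poly \<kappa> s p x t) = (\<lambda>x. tanh_poly \<kappa> s (smult \<kappa> (tanh_pderiv p)) x t)" for p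
    by (intro ext DERIV_imp_deriv tanh_poly_has_derivative_x)
  \<comment> \<open>Replacing division by cosh^2 with the factor 1 - tanh^2 makes both sides of each
    goal polynomials in tanh.\<close>
  have q: "a / (cosh z)\<^sup>2 = a * (1 - (tanh z)\<^sup>2)" for a z :: real
    by (simp add: one_minus_tanh_square)
  show "deriv (\<lambda>x. soliton \<kappa> s x t) x =
     - 24 * \<kappa>^3 * tanh (phase \<kappa> s x t) / (cosh (phase \<kappa> s x t))\<^sup>2"
    unfolding soliton_def d q
    by (simp add: tanh_poly_def tanh_pderiv_def soliton_poly_def pderiv_pCons algebra_simps
        power2_eq_square power3_eq_cube)
  show "deriv (deriv (\<lambda>x. soliton \<kappa> s x t)) x =
     24 * \<kappa>^4 * (3 * (tanh (phase \<kappa> s x t))\<^sup>2 - 1) / (cosh (phase \<kappa> s x t))\<^sup>2"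
    unfolding soliton_def d q
    by (simp add: tanh_poly_def tanh_pderiv_def soliton_poly_def pderiv_pCons algebra_simps
        power2_eq_square power3_eq_cube power4_eq_xxxx)
qed

section \<open>Smallness in H^2 away from the crest\<close>

lemma H2_norm_le:
  assumes "0 < L" "0 \<le> B"
    and "\<And>x. x \<in> {0<..<L} \<Longrightarrow> \<bar>u x\<bar> \<le> B"
    and "\<And>x. x \<in> {0<..<L} \<Longrightarrow> \<bar>deriv u x\<bar> \<le> B"
    and "\<And>x. x \<in> {0<..<L} \<Longrightarrow> \<bar>deriv (deriv u) x\<bar> \<le> B"
  shows "H2_norm L u \<le> sqrt (3 * L) * B"
proof -
  let ?f = "\<lambda>x. (u x)\<^sup>2 + (deriv u x)\<^sup>2 + (deriv (deriv u) x)\<^sup>2"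
  have "(LINT x:{0<..<L}|lborel. ?f x) \<le> (LINT x:{0<..<L}|lborel. 3 * B\<^sup>2)"
    unfolding set_lebesgue_integral_def
  \<comment> \<open>This rule asks for integrability of the majorant only: a non-integrable
    integrand has integral 0 by default, which the nonnegative majorant still dominates.\<close>
  proof (rule integral_mono')
    show "integrable lborel (\<lambda>x. indicat_real {0<..<L} x *\<^sub>R (3 * B\<^sup>2))"
      using integrable_real_indicator[of "{0<..<L}" lborel] assms(1) by simp
    show "indicat_real {0<..<L} x *\<^sub>R ?f x \<le> indicat_real {0<..<L} x *\<^sub>R (3 * B\<^sup>2)" for x
      using power_mono[OF assms(3) abs_ge_zero, of x 2] power_mono[OF assms(4) abs_ge_zero, of x 2]
        power_mono[OF assms(5) abs_ge_zero, of x 2]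
      by (auto simp: indicator_def)
    show "0 \<le> indicat_real {0<..<L} x *\<^sub>R (3 * B\<^sup>2)" for x
      by (auto simp: indicator_def)
  qed
  also have "\<dots> = 3 * L * B\<^sup>2"
    using assms(1) by (simp add: set_lebesgue_integral_def)
  finally have "H2_norm L u \<le> sqrt (3 * L * B\<^sup>2)"
    unfolding H2_norm_def by (rule real_sqrt_le_mono)
  then show ?thesis using assms(2) by (simp add: real_sqrt_mult)
qed

text \<open>In the closed forms, the numerators of u, u_x and u_xx are at most 12 \<kappa>^2, 24
  \<kappa>^3 and 48 \<kappa>^4 in absolute value, all at most 48 \<kappa>^4 as \<kappa> is at least
  1. From 2 cosh z >= exp |z| comes 1 / cosh^2 <= 4 exp (-2 r), and 192 = 48 * 4.\<close>

lemma H2_norm_soliton_le: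
  assumes "0 < L" "1 \<le> \<kappa>" "\<And>x. x \<in> {0<..<L} \<Longrightarrow> r \<le> \<bar>phase \<kappa> s x t\<bar>" "0 \<le> r"
  shows "H2_norm L (\<lambda>x. soliton \<kappa> s x t) \<le> sqrt (3 * L) * (192 * \<kappa>^4 * exp (-2 * r))"
proof (rule H2_norm_le)
  have c: "1 / (cosh (phase \<kappa> s x t))\<^sup>2 \<le> 4 * exp (-2 * r)" if "x \<in> {0<..<L}" for x
  proof -
    let ?z = "phase \<kappa> s x t"
    have "exp r \<le> exp \<bar>?z\<bar>" using assms(3)[OF that] by simp
    also have "\<dots> \<le> 2 * cosh ?z" by (cases "?z \<ge> 0") (auto simp: cosh_def)
    finally have "(exp r)\<^sup>2 \<le> (2 * cosh ?z)\<^sup>2" by (intro power_mono) auto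
    then show ?thesis
      by (simp add: exp_minus field_simps cosh_real_pos flip: exp_double)
  qed
  have t: "\<bar>tanh (phase \<kappa> s x t)\<bar> \<le> 1" "(tanh (phase \<kappa> s x t))\<^sup>2 \<le> 1" for x
    using tanh_real_bounds[of "phase \<kappa> s x t"] by (auto simp: abs_square_le_1 abs_le_iff)
  have b: "\<bar>a / (cosh (phase \<kappa> s x t))\<^sup>2\<bar> \<le> 192 * \<kappa>^4 * exp (-2 * r)"
    if "x \<in> {0<..<L}" "\<bar>a\<bar> \<le> 48 * \<kappa>^4" for a x
  proof -
    have "\<bar>a / (cosh (phase \<kappa> s x t))\<^sup>2\<bar> = \<bar>a\<bar> * (1 / (cosh (phase \<kappa> s x t))\<^sup>2)"
      by (simp add: abs_divide)
    also have "\<dots> \<le> (48 * \<kappa>^4) * (4 * exp (-2 * r))"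
      using c[OF that(1)] that(2) by (intro mult_mono) auto
    finally show ?thesis by simp
  qed
  have "\<kappa>\<^sup>2 \<le> \<kappa>^4" "\<kappa>^3 \<le> \<kappa>^4" "0 \<le> \<kappa>^4"
    using assms(2) by (auto intro!: power_increasing)
  then have k: "\<kappa>\<^sup>2 \<le> 4 * \<kappa>^4" "\<kappa>^3 \<le> 2 * \<kappa>^4"
    by linarith+
  show "0 < L" by fact
  show "0 \<le> 192 * \<kappa>^4 * exp (-2 * r)" by simp
  fix x assume x: "x \<in> {0<..<L}"
  show "\<bar>soliton \<kappa> s x t\<bar> \<le> 192 * \<kappa>^4 * exp (-2 * r)"
    unfolding soliton_altdef by (rule b[OF x]) (use k in simp)
  have "\<kappa>^3 * \<bar>tanh (phase \<kappa> s x t)\<bar> \<le> 2 * \<kappa>^4 * 1"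
    using k t by (intro mult_mono) auto
  then show "\<bar>deriv (\<lambda>x. soliton \<kappa> s x t) x\<bar> \<le> 192 * \<kappa>^4 * exp (-2 * r)"
    unfolding deriv_soliton using assms(2) by (intro b[OF x]) (simp add: abs_mult)
  have "\<kappa>^4 * \<bar>3 * (tanh (phase \<kappa> s x t))\<^sup>2 - 1\<bar> \<le> \<kappa>^4 * 2"
    using t[of x] by (intro mult_left_mono) (auto simp: abs_le_iff intro: order_trans[of _ 0])
  then show "\<bar>deriv (deriv (\<lambda>x. soliton \<kappa> s x t)) x\<bar> \<le> 192 * \<kappa>^4 * exp (-2 * r)"
    unfolding deriv_soliton by (intro b[OF x]) (simp add: abs_mult)
qed

section \<open>Existence of the flow\<close>

lemma soliton_lipschitz:
  assumes "0 \<le> \<kappa>"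
  shows "\<bar>soliton \<kappa> s x t - soliton \<kappa> s x' t\<bar> \<le> 24 * \<kappa>^3 * \<bar>x - x'\<bar>"
proof -
  let ?u = "\<lambda>x. soliton \<kappa> s x t"
  have d: "(?u has_real_derivative deriv ?u x) (at x)" for x
    unfolding soliton_def using tanh_poly_has_derivative_x DERIV_imp_deriv by metis
  have "\<bar>deriv ?u x\<bar> \<le> 24 * \<kappa>^3" for x
  proof -
    have "\<bar>tanh (phase \<kappa> s x t)\<bar> \<le> 1"
      using tanh_real_bounds[of "phase \<kappa> s x t"] by (auto simp: abs_le_iff)
    moreover have "1 \<le> (cosh (phase \<kappa> s x t))\<^sup>2"
      using cosh_real_ge_1 by (simp add: one_le_power)
    ultimately have "24 * \<kappa>^3 * \<bar>tanh (phase \<kappa> s x t)\<bar> / (cosh (phase \<kappa> s x t))\<^sup>2 \<le> 24 * \<kappa>^3 * 1 / 1"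
      using assms by (intro frac_le mult_left_mono) auto
    then show ?thesis
      using assms by (simp add: deriv_soliton abs_mult)
  qed
  with field_differentiable_bound[of UNIV ?u "deriv ?u" "24 * \<kappa>^3" x x'] d
  show ?thesis by (simp add: abs_minus_commute)
qed

text \<open>The weight \<open>exp (- \<alpha> t)\<close> makes the Picard operator a contraction on the whole interval.\<close>
lemma global_picard:
  fixes f :: "real \<Rightarrow> real \<Rightarrow> real"
  assumes "0 \<le> T" "0 \<le> K"
    and cont: "continuous_on UNIV (\<lambda>(x, t). f x t)"
    and lip: "\<And>x x' t. \<bar>f x t - f x' t\<bar> \<le> K * \<bar>x - x'\<bar>"
  shows "\<exists>\<phi>. \<phi> 0 = x\<^sub>0 \<and> (\<forall>t\<in>{0..T}. (\<phi> has_real_derivative f (\<phi> t) t) (at t within {0..T}))"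
proof -
  \<comment> \<open>This choice gives K / \<alpha> <= 1/2, and \<alpha> > 0 even if K = 0.\<close>
  define \<alpha> where "\<alpha> = 2 * K + 1"
  \<comment> \<open>Clamping time to \<open>{0..T}\<close> makes the image of the operator a bounded
    continuous function on the whole line, so that the complete space of \<open>bcontfun\<close> can
    be used.\<close>
  define c where "c = (\<lambda>t. max 0 (min T t))"
  \<comment> \<open>The unknown \<open>g\<close> stands for exp (-\<alpha> t) times the trajectory;
    its sup distance is thus the weighted distance of trajectories.\<close>
  define h where "h = (\<lambda>(g :: real \<Rightarrow>\<^sub>C real) s. f (exp (\<alpha> * s) * apply_bcontfun g s) s)"
  define P where "P = (\<lambda>g t. exp (- \<alpha> * c t) * (x\<^sub>0 + integral {0..c t} (h g)))"
  have \<alpha>: "\<alpha> > 0" using assms(2) by (simp add: \<alpha>_def)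
  have c: "c t \<in> {0..T}" for t using assms(1) by (auto simp: c_def)
  have cc: "continuous_on A c" for A unfolding c_def by (intro continuous_intros)
  have h: "continuous_on A (h g)" for g A
    unfolding h_def
    by (rule continuous_on_compose2[OF cont, of A "\<lambda>s. (exp (\<alpha> * s) * apply_bcontfun g s, s)", simplified])
       (intro continuous_intros, auto)
  have "P g \<in> bcontfun" for g
  proof -
    have 1: "continuous_on {0..T} (\<lambda>t. exp (- \<alpha> * t) * (x\<^sub>0 + integral {0..t} (h g)))"
      by (intro continuous_intros indefinite_integral_continuous_1 integrable_continuous_real h)
    have "continuous_on UNIV (P g)"
      unfolding P_def
      by (rule continuous_on_compose2[OF 1 cc]) (use c in auto)
    moreover have "bounded (range (P g))"
      by (rule bounded_subset[OF compact_imp_bounded[OF compact_continuous_image[OF 1 compact_Icc]]])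
         (use c in \<open>auto simp: P_def\<close>)
    ultimately show ?thesis by (simp add: bcontfun_def)
  qed
  then have P: "apply_bcontfun (Bcontfun (P g)) = P g" for g
    by (simp add: Bcontfun_inverse)
  have con: "dist (Bcontfun (P g)) (Bcontfun (P g')) \<le> (1/2) * dist g g'" for g g'
  proof (rule dist_bound)
    fix t
    let ?D = "dist g g'"
    have "\<bar>integral {0..c t} (h g) - integral {0..c t} (h g')\<bar> = \<bar>integral {0..c t} (\<lambda>s. h g s - h g' s)\<bar>"
      by (simp add: integral_diff integrable_continuous_real h)
    also have "\<dots> \<le> integral {0..c t} (\<lambda>s. K * ?D * exp (\<alpha> * s))"
    proof (rule integral_norm_bound_integral[where 'a = real and 'n = real, unfolded real_norm_def])
      show "(\<lambda>s. h g s - h g' s) integrable_on {0..c t}"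
        by (intro integrable_continuous_real continuous_intros h)
      show "(\<lambda>s. K * ?D * exp (\<alpha> * s)) integrable_on {0..c t}"
        by (intro integrable_continuous_real continuous_intros)
      fix s assume "s \<in> {0..c t}"
      have "\<bar>h g s - h g' s\<bar> \<le> K * \<bar>exp (\<alpha> * s) * apply_bcontfun g s - exp (\<alpha> * s) * apply_bcontfun g' s\<bar>"
        unfolding h_def by (rule lip)
      also have "\<dots> = K * (exp (\<alpha> * s) * dist (apply_bcontfun g s) (apply_bcontfun g' s))"
        by (simp add: dist_real_def abs_mult flip: right_diff_distrib)
      also have "\<dots> \<le> K * (exp (\<alpha> * s) * ?D)"
        using assms(2) by (intro mult_left_mono dist_bounded) auto
      finally show "\<bar>h g s - h g' s\<bar> \<le> K * ?D * exp (\<alpha> * s)" by (simp add: mult_ac)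
    qed
    \<comment> \<open>The integral of exp (\<alpha> s) is below exp (\<alpha> \<open>c t\<close>) /
      \<alpha>. The weight in \<open>P\<close> cancels this exponential and leaves the factor K /
      \<alpha>.\<close>
    also have "\<dots> = K * ?D * ((exp (\<alpha> * c t) - 1) / \<alpha>)"
    proof -
      have "((\<lambda>s. exp (\<alpha> * s)) has_integral (exp (\<alpha> * c t) / \<alpha> - exp (\<alpha> * 0) / \<alpha>)) {0..c t}"
        using c[of t] \<alpha>
        by (intro fundamental_theorem_of_calculus)
           (auto intro!: derivative_eq_intros simp flip: has_real_derivative_iff_has_vector_derivative)
      from integral_unique[OF this] show ?thesis by (simp add: diff_divide_distrib)
    qed
    also have "\<dots> \<le> K * ?D * (exp (\<alpha> * c t) / \<alpha>)"
      using assms(2) \<alpha> by (intro mult_left_mono divide_right_mono) auto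
    finally have I: "\<bar>integral {0..c t} (h g) - integral {0..c t} (h g')\<bar> \<le> K * ?D * (exp (\<alpha> * c t) / \<alpha>)" .
    have "dist (P g t) (P g' t) =
        exp (- \<alpha> * c t) * \<bar>integral {0..c t} (h g) - integral {0..c t} (h g')\<bar>"
      by (simp add: P_def dist_real_def abs_mult flip: right_diff_distrib)
    also have "\<dots> \<le> exp (- \<alpha> * c t) * (K * ?D * (exp (\<alpha> * c t) / \<alpha>))"
      by (intro mult_left_mono I) auto
    also have "\<dots> = K / \<alpha> * ?D"
      by (simp add: exp_minus)
    also have "\<dots> \<le> 1 / 2 * ?D"
      using assms(2) by (intro mult_right_mono) (auto simp: \<alpha>_def field_simps)
    finally show "dist (apply_bcontfun (Bcontfun (P g)) t) (apply_bcontfun (Bcontfun (P g')) t) \<le> 1/2 * ?D"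
      by (simp add: P)
  qed
  have "\<exists>!g. Bcontfun (P g) = g"
    using banach_fix_type[of "1/2" "\<lambda>g. Bcontfun (P g)"] con by simp
  then obtain g where g: "Bcontfun (P g) = g" by blast
  \<comment> \<open>Removes the weight from the fixed point; on \<open>{0..T}\<close>, where
    \<open>c\<close> is the identity, the result is exp (\<alpha> t) times \<open>g\<close>.\<close>
  define \<phi> where "\<phi> = (\<lambda>t. x\<^sub>0 + integral {0..t} (h g))"
  have hg: "h g t = f (\<phi> t) t" if "t \<in> {0..T}" for t
  proof -
    have "apply_bcontfun g t = exp (- \<alpha> * t) * \<phi> t"
      using P[of g] that unfolding g by (simp add: P_def c_def \<phi>_def)
    then have "exp (\<alpha> * t) * apply_bcontfun g t = \<phi> t"
      by (simp add: exp_minus)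
    then show ?thesis by (simp add: h_def)
  qed
  have "(\<phi> has_real_derivative f (\<phi> t) t) (at t within {0..T})" if "t \<in> {0..T}" for t
  proof -
    have "((\<lambda>u. integral {0..u} (h g)) has_real_derivative h g t) (at t within {0..T})"
      using integral_has_real_derivative[OF h that] .
    then have "(\<phi> has_real_derivative h g t) (at t within {0..T})"
      unfolding \<phi>_def by (auto intro!: derivative_eq_intros)
    then show ?thesis by (simp add: hg[OF that])
  qed
  moreover have "\<phi> 0 = x\<^sub>0" by (simp add: \<phi>_def)
  ultimately show ?thesis by blast
qed

text \<open>As a composition with a 1-Lipschitz clamp, the extended velocity inherits joint
  continuity, Lipschitz constant and positivity from \<open>y\<close>.\<close>

lemma yhat_clamp: "0 \<le> L \<Longrightarrow> yhat L y x t = y (max 0 (min L x)) t"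
  by (auto simp: yhat_def max_def min_def)

lemma ex_flow_soliton:
  assumes "0 < L" "0 < T" "0 \<le> \<kappa>"
  shows "\<exists>\<Phi>. is_flow L T (soliton \<kappa> s) \<Phi>"
proof -
  have "\<exists>\<phi>. \<phi> 0 = x \<and> (\<forall>t\<in>{0..T}. (\<phi> has_real_derivative yhat L (soliton \<kappa> s) (\<phi> t) t) (at t within {0..T}))" for x
  proof (rule global_picard)
    show "0 \<le> T" "0 \<le> 24 * \<kappa>^3" using assms by auto
    have "continuous_on UNIV (\<lambda>z. tanh_poly \<kappa> s (soliton_poly \<kappa>) (max 0 (min L (fst z))) (snd z))"
      unfolding tanh_poly_def phase_def by (intro continuous_intros) simp
    then show "continuous_on UNIV (\<lambda>(x, t). yhat L (soliton \<kappa> s) x t)"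
      using assms(1) by (simp add: yhat_clamp soliton_def case_prod_unfold)
    fix x x' t
    have "\<bar>yhat L (soliton \<kappa> s) x t - yhat L (soliton \<kappa> s) x' t\<bar>
        \<le> 24 * \<kappa>^3 * \<bar>max 0 (min L x) - max 0 (min L x')\<bar>"
      using assms(1) soliton_lipschitz[OF assms(3)] by (simp add: yhat_clamp)
    also have "\<dots> \<le> 24 * \<kappa>^3 * \<bar>x - x'\<bar>"
      using assms(3) by (intro mult_left_mono) auto
    finally show "\<bar>yhat L (soliton \<kappa> s) x t - yhat L (soliton \<kappa> s) x' t\<bar> \<le> 24 * \<kappa>^3 * \<bar>x - x'\<bar>" .
  qed
  then obtain \<Phi> where "\<And>x. \<Phi> x 0 = x \<and> (\<forall>t\<in>{0..T}. (\<Phi> x has_real_derivative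
      yhat L (soliton \<kappa> s) (\<Phi> x t) t) (at t within {0..T}))"
    by metis
  then show ?thesis unfolding is_flow_def by (intro exI[of _ \<Phi>]) auto
qed

section \<open>Particles ahead of the crest are swept past L\<close>

text \<open>Otherwise there is a first zero. A positive derivative there makes \<open>h\<close>
  negative just before it, and since \<open>h a\<close> is positive, the intermediate value theorem
  yields an earlier zero.\<close>

lemma stays_nonneg_if_deriv_pos_at_zeros:
  fixes h :: "real \<Rightarrow> real"
  assumes "a \<le> b" "0 < h a"
    and "\<And>t. t \<in> {a..b} \<Longrightarrow> (h has_real_derivative h' t) (at t within {a..b})"
    and "\<And>t. t \<in> {a..b} \<Longrightarrow> h t = 0 \<Longrightarrow> 0 < h' t"
  shows "0 \<le> h b"
proof (rule ccontr)
  assume neg: "\<not> 0 \<le> h b"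
  have cont: "continuous_on {a..b} h"
    using assms(3) by (rule DERIV_continuous_on)
  let ?Z = "{t \<in> {a..b}. h t = 0}"
  have "\<exists>t\<ge>a. t \<le> b \<and> h t = 0"
    using neg assms(1,2) by (intro IVT2' cont) auto
  then have "?Z \<noteq> {}" by auto
  moreover have "compact ?Z"
    unfolding compact_eq_bounded_closed
  proof
    show "bounded ?Z" by (rule bounded_subset[OF bounded_closed_interval[of a b]]) auto
    show "closed ?Z" by (rule continuous_closed_preimage_constant[OF cont closed_atLeastAtMost])
  qed
  ultimately obtain t where t: "t \<in> ?Z" "\<And>u. u \<in> ?Z \<Longrightarrow> t \<le> u"
    using compact_attains_inf[of ?Z] by blast
  have "a < t" using t(1) assms(2) by (cases "t = a") auto
  obtain d where d: "d > 0" "\<And>e. e > 0 \<Longrightarrow> t - e \<in> {a..b} \<Longrightarrow> e < d \<Longrightarrow> h (t - e) < h t"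
    using has_real_derivative_pos_inc_left[OF assms(3) assms(4), of t] t(1) by auto
  \<comment> \<open>The minimum keeps \<open>u\<close> within \<open>d\<close> of \<open>t\<close>
    without going below \<open>a\<close>.\<close>
  define u where "u = t - min (d/2) (t - a)"
  have u: "a \<le> u" "u < t" "h u < 0"
    using d(1) d(2)[of "min (d/2) (t - a)"] \<open>a < t\<close> t(1) by (auto simp: u_def min_def)
  have "\<exists>v\<ge>a. v \<le> u \<and> h v = 0"
    using u t(1) assms(2) by (intro IVT2' continuous_on_subset[OF cont]) auto
  then obtain v where "a \<le> v" "v \<le> u" "h v = 0" by auto
  with t(2)[of v] u t(1) show False by auto
qed

text \<open>A particle still short of L at time t has never left [0, L], because velocities are
  positive, so it moves with the soliton itself. It starts ahead of the crest, whose position at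
  time 0 is negative; at any meeting its velocity 12 \<kappa>^2 exceeds the crest speed. It is
  therefore not behind the crest at time t, while the crest has reached L: a contradiction.\<close>

lemma flow_soliton_ge:
  assumes "0 < L" "1 \<le> \<kappa>" "0 < s" and flow: "is_flow L T (soliton \<kappa> s) \<Phi>"
    and x: "x \<in> {0..L}" and t: "t \<le> T" "L \<le> (1 + 4 * \<kappa>\<^sup>2) * (t - s)"
  shows "L \<le> \<Phi> x t"
proof (rule ccontr)
  assume less: "\<not> L \<le> \<Phi> x t"
  define c where "c = 1 + 4 * \<kappa>\<^sup>2"
  have "1 \<le> \<kappa>\<^sup>2" using assms(2) by (rule one_le_power)
  then have c: "0 < c" "c < 12 * \<kappa>\<^sup>2" by (simp_all add: c_def)
  have "0 < c * (t - s)" using t(2) assms(1) by (simp add: c_def)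
  then have "s < t" using c(1) by (simp add: zero_less_mult_iff)
  with assms(3) have t0: "0 < t" by simp
  have init: "\<Phi> x 0 = x" using flow by (simp add: is_flow_def)
  have D: "(\<Phi> x has_real_derivative yhat L (soliton \<kappa> s) (\<Phi> x u) u) (at u within {0..t})"
    if "u \<in> {0..t}" for u
    by (rule DERIV_subset[of _ _ _ "{0..T}"]) (use flow that t(1) in \<open>auto simp: is_flow_def\<close>)
  have pos: "0 < yhat L (soliton \<kappa> s) z u" for z u
    using assms(1,2) by (simp add: yhat_clamp soliton_pos)
  have mono: "\<Phi> x u \<le> \<Phi> x v" if "0 \<le> u" "u \<le> v" "v \<le> t" for u v
  proof (cases "u = v")
    case False
    have "\<exists>z\<in>{u<..<v}. \<Phi> x v - \<Phi> x u = yhat L (soliton \<kappa> s) (\<Phi> x z) z * (v - u)"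
    proof (rule mvt_simple)
      show "u < v" using that False by simp
      show "(\<Phi> x has_derivative (*) (yhat L (soliton \<kappa> s) (\<Phi> x z) z)) (at z within {u..v})"
        if "u \<le> z" "z \<le> v" for z
        using DERIV_subset[OF D[of z], of "{u..v}"] that \<open>0 \<le> u\<close> \<open>v \<le> t\<close>
        by (auto simp: has_field_derivative_def)
    qed
    then obtain z where "\<Phi> x v - \<Phi> x u = yhat L (soliton \<kappa> s) (\<Phi> x z) z * (v - u)" by blast
    moreover have "0 \<le> yhat L (soliton \<kappa> s) (\<Phi> x z) z * (v - u)"
      using pos[of "\<Phi> x z" z] \<open>u \<le> v\<close> by simp
    ultimately show ?thesis by simp
  qed simp
  have inside: "\<Phi> x u \<in> {0..L}" if "u \<in> {0..t}" for u
    using mono[of 0 u] mono[of u t] that init x less by auto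
  have "0 \<le> \<Phi> x t - c * (t - s)"
  \<comment> \<open>The function is the lead of the particle over the crest. At its zeros the phase
    vanishes, so the soliton takes its maximal value.\<close>
  proof (rule stays_nonneg_if_deriv_pos_at_zeros[of 0 t "\<lambda>u. \<Phi> x u - c * (u - s)"])
    show "0 \<le> t" using t0 by simp
    show "0 < \<Phi> x 0 - c * (0 - s)" using x init c(1) assms(3) by (simp add: add_nonneg_pos)
    show "((\<lambda>u. \<Phi> x u - c * (u - s)) has_real_derivative
        yhat L (soliton \<kappa> s) (\<Phi> x u) u - c) (at u within {0..t})" if "u \<in> {0..t}" for u
      using D[OF that] by (auto intro!: derivative_eq_intros)
    fix u assume u: "u \<in> {0..t}" "\<Phi> x u - c * (u - s) = 0"
    have "yhat L (soliton \<kappa> s) (\<Phi> x u) u = soliton \<kappa> s (\<Phi> x u) u"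
      using inside[OF u(1)] by (auto simp: yhat_def)
    also have "\<dots> = 12 * \<kappa>\<^sup>2"
      using u(2) by (simp add: soliton_altdef phase_def flip: c_def)
    finally show "0 < yhat L (soliton \<kappa> s) (\<Phi> x u) u - c" using c(2) by simp
  qed
  with t(2) less show False by (simp add: c_def)
qed

section \<open>Choice of \<kappa> and conclusion\<close>

theorem theorem1p4:
  fixes L T \<delta> \<epsilon>\<^sub>1 \<epsilon>\<^sub>2 :: real
  assumes "L > 0" and "T > 0" and "\<delta> > 0"
    and "\<epsilon>\<^sub>1 \<in> {0<..<T/2}" and "\<epsilon>\<^sub>2 \<in> {0<..<T/2}"
  shows "\<exists>y :: real \<Rightarrow> real \<Rightarrow> real.
    (\<forall>x. \<forall>t\<in>{0..T}. y x t > 0) \<and>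
    smooth_strip T y \<and>
    solves_KdV T y \<and>
    (\<forall>t \<in> {0<..<\<epsilon>\<^sub>1} \<union> {T - \<epsilon>\<^sub>2<..<T}. H2_norm L (\<lambda>x. y x t) < \<delta>) \<and>
    (\<exists>\<Phi>. is_flow L T y \<Phi>) \<and>
    (\<forall>\<Phi>. is_flow L T y \<Phi> \<longrightarrow> (\<forall>x\<in>{0..L}. \<forall>t\<in>{T - \<epsilon>\<^sub>2<..<T}. \<Phi> x t \<ge> L))"
proof -
  \<comment> \<open>Both time windows keep distance at least \<open>a\<close> from T/2, the time at
    which the crest is at 0.\<close>
  define a where "a = min (T/2 - \<epsilon>\<^sub>1) (T/2 - \<epsilon>\<^sub>2)"
  have a: "0 < a" using assms by (simp add: a_def)
  have "((\<lambda>\<kappa>. sqrt (3 * L) * (192 * \<kappa>^4 * exp (-2 * (\<kappa> * a)))) \<longlongrightarrow> 0) at_top"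
    using a by real_asymp
  then have "\<forall>\<^sub>F \<kappa> in at_top. sqrt (3 * L) * (192 * \<kappa>^4 * exp (-2 * (\<kappa> * a))) < \<delta>"
    using assms(3) by (rule order_tendstoD(2))
  moreover have "\<forall>\<^sub>F \<kappa>::real in at_top. 1 \<le> \<kappa>" by (rule eventually_ge_at_top)
  \<comment> \<open>Equivalent to a + L <= (1 + 4 \<kappa>^2) a: by time T/2 + a the crest is at
    least \<open>a\<close> beyond L.\<close>
  moreover have "\<forall>\<^sub>F \<kappa>::real in at_top. L \<le> 4 * \<kappa>\<^sup>2 * a" using a by real_asymp
  ultimately have "\<forall>\<^sub>F \<kappa> in at_top. sqrt (3 * L) * (192 * \<kappa>^4 * exp (-2 * (\<kappa> * a))) < \<delta> \<and>
      1 \<le> \<kappa> \<and> L \<le> 4 * \<kappa>\<^sup>2 * a"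
    by eventually_elim simp
  then obtain \<kappa> where \<kappa>: "sqrt (3 * L) * (192 * \<kappa>^4 * exp (-2 * (\<kappa> * a))) < \<delta>"
      "1 \<le> \<kappa>" "L \<le> 4 * \<kappa>\<^sup>2 * a"
    using eventually_happens'[OF trivial_limit_at_top_linorder] by blast
  define c where "c = 1 + 4 * \<kappa>\<^sup>2"
  have c: "1 \<le> c" "a + L \<le> c * a" using \<kappa> by (auto simp: c_def algebra_simps)
  let ?y = "soliton \<kappa> (T/2)"
  \<comment> \<open>A distance \<open>a\<close> between crest and (0, L), independent of \<kappa>,
    is enough, as the phase multiplies it by \<kappa>. Early on the crest is at or below -a because
    the speed is at least 1; late it is at or above L + a.\<close>
  have far: "\<kappa> * a \<le> \<bar>phase \<kappa> (T/2) x t\<bar>"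
    if t: "t \<in> {0<..<\<epsilon>\<^sub>1} \<union> {T - \<epsilon>\<^sub>2<..<T}" and x: "x \<in> {0<..<L}" for x t
  proof -
    have "a \<le> T/2 - t \<or> a \<le> t - T/2" using t by (auto simp: a_def min_def)
    then have "c * a \<le> c * (T/2 - t) \<or> c * a \<le> c * (t - T/2)"
      using c(1) by (auto intro!: mult_left_mono)
    then have "a \<le> \<bar>x - c * (t - T/2)\<bar>"
      using c x assms(1) by (auto simp: algebra_simps)
    then show ?thesis using \<kappa>(2) by (simp add: phase_def abs_mult flip: c_def)
  qed
  have "H2_norm L (\<lambda>x. ?y x t) < \<delta>" if "t \<in> {0<..<\<epsilon>\<^sub>1} \<union> {T - \<epsilon>\<^sub>2<..<T}" for t
    using H2_norm_soliton_le[OF assms(1) \<kappa>(2) far[OF that]] \<kappa>(1,2) a by fastforce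
  moreover have "L \<le> \<Phi> x t"
    if "is_flow L T ?y \<Phi>" "x \<in> {0..L}" "t \<in> {T - \<epsilon>\<^sub>2<..<T}" for \<Phi> x t
  proof (rule flow_soliton_ge[OF assms(1) \<kappa>(2) _ that(1,2)])
    have "c * a \<le> c * (t - T/2)"
      using that(3) c(1) by (intro mult_left_mono) (auto simp: a_def min_def)
    then show "L \<le> (1 + 4 * \<kappa>\<^sup>2) * (t - T/2)"
      unfolding c_def[symmetric] using c(2) a by linarith
  qed (use assms(2) that(3) in auto)
  moreover have "\<forall>x. \<forall>t\<in>{0..T}. 0 < ?y x t" using \<kappa>(2) by (simp add: soliton_pos)
  moreover have "smooth_strip T ?y"
    unfolding smooth_strip_def soliton_def using Ck_strip_tanh_poly[OF assms(2)] by blast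
  moreover have "solves_KdV T ?y" by (rule soliton_solves_KdV[OF assms(2)])
  moreover have "\<exists>\<Phi>. is_flow L T ?y \<Phi>" using ex_flow_soliton assms \<kappa>(2) by simp
  ultimately show ?thesis by (intro exI[of _ ?y]) blast
qed

end
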